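(* Let $H$ be a complex Hilbert space with $\dim H\geq 2$ and let $\phi:E(H)\to E(H)$ be a bijective map which preserves the order in both directions, i.e., $A\leq B\Longleftrightarrow\phi(A)\leq\phi(B)$ for all $A,B\in E(H)$. Suppose that there is a single pair of scalars $\lambda,\mu\in\,]0,1[$ such that $\phi(\lambda I)=\mu I$. Then $\phi$ preserves zero product in both directions, i.e., $AB=0\Longleftrightarrow\phi(A)\phi(B)=0$ for all $A,B\in E(H)$.
   Context: $E(H)$ denotes the set of all (Hilbert space) effects on $H$, i.e., all positive bounded linear operators $A$ on $H$ with $0\leq A\leq I$, where $I$ is the identity. The order $\leq$ is the usual order among self-adjoint bounded linear operators. $]0,1[$ is the open unit interval. The phrase "there is a single pair" means that the existence of at least one such pair is assumed. *)

theory Defs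
  imports "HOL-Analysis.Analysis" "HOL-Library.Extended_Nat"
begin

class complex_vector = real_vector +
  fixes scaleC :: "complex \<Rightarrow> 'a \<Rightarrow> 'a"  (infixr "*\<^sub>C" 75)
  assumes scaleC_add_right: "c *\<^sub>C (x + y) = c *\<^sub>C x + c *\<^sub>C y"
    and scaleC_add_left: "(c + d) *\<^sub>C x = c *\<^sub>C x + d *\<^sub>C x"
    and scaleC_scaleC: "c *\<^sub>C (d *\<^sub>C x) = (c * d) *\<^sub>C x"
    and scaleC_one: "1 *\<^sub>C x = x"
    and scaleR_scaleC: "r *\<^sub>R x = complex_of_real r *\<^sub>C x"

global_interpretation complex_vector:
  vector_space "scaleC :: complex \<Rightarrow> 'a \<Rightarrow> 'a::complex_vector"
  by unfold_locales
    (simp_all add: scaleC_add_right scaleC_add_left scaleC_scaleC scaleC_one)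

text \<open>The complex inner product is linear in its first and conjugate linear in its second
  argument. Its real part is the real inner product of the underlying real space, so the norm,
  the metric and the topology inherited from \<^class>\<open>real_inner\<close> are those induced by
  the complex inner product.\<close>

class complex_inner = complex_vector + real_inner +
  fixes cinner :: "'a \<Rightarrow> 'a \<Rightarrow> complex"
  assumes cinner_commute: "cinner x y = cnj (cinner y x)"
    and cinner_add_left: "cinner (x + y) z = cinner x z + cinner y z"
    and cinner_scaleC_left: "cinner (c *\<^sub>C x) y = c * cinner x y"
    and inner_eq_Re_cinner: "inner x y = Re (cinner x y)"

class complex_hilbert = complex_inner + banach

text \<open>The library's \<^term>\<open>complex_vector.dim\<close> is \<open>0\<close> on infinite-dimensional spaces,
  hence the value in \<^typ>\<open>enat\<close>.\<close>

definition cdim :: "'a::complex_vector itself \<Rightarrow> enat" where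
  "cdim _ = (if \<exists>B :: 'a set. finite B \<and> complex_vector.span B = UNIV
             then enat (complex_vector.dim (UNIV :: 'a set)) else \<infinity>)"

text \<open>Operators are represented by the type of real-linear bounded operators;
  complex linearity is required separately.\<close>

definition complex_linear :: "('a::complex_inner \<Rightarrow>\<^sub>L 'a) \<Rightarrow> bool" where
  "complex_linear A \<longleftrightarrow> Vector_Spaces.linear scaleC scaleC (blinfun_apply A)"

definition selfadjoint :: "('a::complex_inner \<Rightarrow>\<^sub>L 'a) \<Rightarrow> bool" where
  "selfadjoint A \<longleftrightarrow> (\<forall>x y. cinner (blinfun_apply A x) y = cinner x (blinfun_apply A y))"

text \<open>Only used between self-adjoint operators, whose quadratic forms are real valued,
  so that taking real parts loses nothing.\<close>

definition op_le :: "('a::complex_inner \<Rightarrow>\<^sub>L 'a) \<Rightarrow> ('a \<Rightarrow>\<^sub>L 'a) \<Rightarrow> bool"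
    (infix "\<preceq>" 50) where
  "A \<preceq> B \<longleftrightarrow>
     (\<forall>x. Re (cinner (blinfun_apply A x) x) \<le> Re (cinner (blinfun_apply B x) x))"

definition effects :: "('a::complex_inner \<Rightarrow>\<^sub>L 'a) set" where
  "effects = {A. complex_linear A \<and> selfadjoint A \<and> 0 \<preceq> A \<and> A \<preceq> id_blinfun}"

end

theory Submission
  imports Defs
begin

text \<open>The idea is that, once a single scalar operator \<open>\<lambda>I\<close> with \<open>0 < \<lambda> < 1\<close> is singled out,
  the relation \<open>AB = 0\<close> can be expressed by the order of the effects alone. Writing
  \<open>P\<^sub>x\<close> for the projection onto the line of a unit vector \<open>x\<close>, three observations do this.

  \<^item> The nonzero effects with a totally ordered set of effects below them are those of rank one,
    and the maximal ones among them are the projections \<open>P\<^sub>x\<close>. The Cauchy--Schwarz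
    inequality for the form of \<open>A\<close> gives enough rank-one operators below \<open>A\<close> to prove this.

  \<^item> An effect above \<open>P\<^sub>x\<close> fixes \<open>x\<close>, so that \<open>P\<^sub>x\<close> and \<open>\<lambda>I\<close> have the least upper
    bound \<open>T = \<lambda>I + (1 - \<lambda>)P\<^sub>x\<close>. The largest \<open>t\<close> with \<open>tP\<^sub>y \<le> T\<close> satisfies
    \<open>1 / t = \<langle>T\<inverse> y, y\<rangle> = \<bar>\<langle>x, y\<rangle>\<bar>\<^sup>2 + (1 - \<bar>\<langle>x, y\<rangle>\<bar>\<^sup>2) / \<lambda>\<close>. It equals \<open>\<lambda>\<close>, the value for
    \<open>\<lambda>I\<close> itself, exactly if \<open>x\<close> and \<open>y\<close> are orthogonal. Hence orthogonality of lines means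
    that every effect below \<open>P\<^sub>y\<close> and below the join of \<open>P\<^sub>x\<close> and \<open>\<lambda>I\<close> is below \<open>\<lambda>I\<close>; this is
    \<open>separated_at_iff_orthogonal\<close>.

  \<^item> \<open>AB = 0\<close> holds exactly if every line with a nonzero rank-one operator below \<open>A\<close> is
    orthogonal to every such line for \<open>B\<close>; this is \<open>zero_product_iff\<close>.

  An order automorphism carries each of these descriptions over to the images. As it maps
  \<open>\<lambda>I\<close> to \<open>\<mu>I\<close> with \<open>0 < \<mu> < 1\<close>, the transported description, now relative to \<open>\<mu>I\<close>, again
  says that the product is zero.\<close>

section \<open>Complex inner products and positive operators\<close>

lemma cinner_add_right: "cinner x (y + z) = cinner x y + cinner x z" for x :: "'a::complex_inner"
  by (metis cinner_add_left cinner_commute complex_cnj_add)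

lemma cinner_scaleC_right: "cinner x (c *\<^sub>C y) = cnj c * cinner x y" for x :: "'a::complex_inner"
  by (metis cinner_scaleC_left cinner_commute complex_cnj_mult)

lemma cinner_scaleR_left: "cinner (r *\<^sub>R x) y = of_real r * cinner x y" for x :: "'a::complex_inner"
  by (simp add: scaleR_scaleC cinner_scaleC_left)

lemma cinner_scaleR_right: "cinner x (r *\<^sub>R y) = of_real r * cinner x y" for x :: "'a::complex_inner"
  by (simp add: scaleR_scaleC cinner_scaleC_right)

lemma cinner_diff_left: "cinner (x - y) z = cinner x z - cinner y z" for x :: "'a::complex_inner"
  by (metis add_diff_cancel_right' cinner_add_left diff_add_cancel)

lemma cinner_diff_right: "cinner x (y - z) = cinner x y - cinner x z" for x :: "'a::complex_inner"
  by (metis add_diff_cancel_right' cinner_add_right diff_add_cancel)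

lemma cinner_zero_left [simp]: "cinner 0 z = 0" for z :: "'a::complex_inner"
  using cinner_diff_left[of 0 0 z] by simp

lemma cinner_zero_right [simp]: "cinner z 0 = 0" for z :: "'a::complex_inner"
  using cinner_diff_right[of z 0 0] by simp

lemma cinner_self: "cinner x x = of_real ((norm x)\<^sup>2)" for x :: "'a::complex_inner"
proof (rule complex_eqI)
  show "Re (cinner x x) = Re (of_real ((norm x)\<^sup>2))"
    by (simp add: inner_eq_Re_cinner[symmetric] power2_norm_eq_inner)
  show "Im (cinner x x) = Im (of_real ((norm x)\<^sup>2))"
    using cinner_commute[of x x] by (simp add: complex_eq_iff)
qed

lemmas cinner_simps =
  cinner_add_left cinner_add_right cinner_diff_left cinner_diff_right
  cinner_scaleC_left cinner_scaleC_right cinner_scaleR_left cinner_scaleR_right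

lemma norm_scaleC: "norm (c *\<^sub>C x) = cmod c * norm x" for x :: "'a::complex_inner"
proof -
  have "complex_of_real ((norm (c *\<^sub>C x))\<^sup>2) = (c * cnj c) * of_real ((norm x)\<^sup>2)"
    unfolding cinner_self[symmetric] by (simp add: cinner_simps)
  also have "\<dots> = of_real ((cmod c * norm x)\<^sup>2)"
    using complex_norm_square[of c] by (simp add: power_mult_distrib)
  finally have "complex_of_real ((norm (c *\<^sub>C x))\<^sup>2) = of_real ((cmod c * norm x)\<^sup>2)" .
  then show ?thesis
    by (metis of_real_eq_iff norm_ge_zero mult_nonneg_nonneg power2_eq_iff_nonneg)
qed

lemma complex_linear_iff: "complex_linear A \<longleftrightarrow> (\<forall>c x. A (c *\<^sub>C x) = c *\<^sub>C A x)"
  unfolding complex_linear_def Vector_Spaces.linear_def module_hom_def module_hom_axioms_def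
  using complex_vector.vector_space_axioms complex_vector.module_axioms
  by (auto simp: blinfun.add_right)

definition positive_op :: "('a::complex_inner \<Rightarrow>\<^sub>L 'a) \<Rightarrow> bool" where
  "positive_op A \<longleftrightarrow> complex_linear A \<and> selfadjoint A \<and> 0 \<preceq> A"

lemma positive_opD:
  assumes "positive_op A"
  shows "A (c *\<^sub>C x) = c *\<^sub>C A x" "cinner (A x) y = cinner x (A y)" "0 \<le> Re (cinner (A x) x)"
  using assms by (auto simp: positive_op_def complex_linear_iff selfadjoint_def op_le_def)

lemma effects_iff: "A \<in> effects \<longleftrightarrow> positive_op A \<and> A \<preceq> id_blinfun"
  by (auto simp: effects_def positive_op_def)

lemma positive_op_id: "positive_op id_blinfun"
  by (auto simp: positive_op_def complex_linear_iff selfadjoint_def op_le_def cinner_self)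

lemma cinner_selfadjoint_real:
  assumes "positive_op A"
  shows "cinner (A x) x = of_real (Re (cinner (A x) x))"
  using positive_opD(2)[OF assms, of x x] cinner_commute[of "A x" x]
  by (simp add: complex_eq_iff)

text \<open>Positivity at \<open>x - t c y\<close> with \<open>c = \<langle>A x, y\<rangle>\<close> and a suitable real \<open>t\<close> gives this
  Cauchy--Schwarz inequality. The form of \<^term>\<open>A\<close> is only semidefinite, so the case in which it
  vanishes at \<^term>\<open>y\<close> needs its own choice of \<open>t\<close>.\<close>

lemma positive_op_Cauchy_Schwarz:
  assumes A: "positive_op A"
  shows "(cmod (cinner (A x) y))\<^sup>2 \<le> Re (cinner (A x) x) * Re (cinner (A y) y)"
proof -
  define a b c where "a = Re (cinner (A x) x)" and "b = Re (cinner (A y) y)"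
    and "c = cinner (A x) y"
  have c': "cinner (A y) x = cnj c"
    by (metis A c_def cinner_commute positive_opD(2))
  have ab: "cinner (A x) x = of_real a" "cinner (A y) y = of_real b"
    using cinner_selfadjoint_real[OF A] by (simp_all add: a_def b_def)
  have ge: "0 \<le> a - 2 * t * (cmod c)\<^sup>2 + t\<^sup>2 * (cmod c)\<^sup>2 * b" for t
  proof -
    let ?s = "of_real t * c"
    have "cinner (A (x - ?s *\<^sub>C y)) (x - ?s *\<^sub>C y) =
        of_real a - 2 * of_real t * (c * cnj c) + (of_real t)\<^sup>2 * (c * cnj c) * of_real b"
      by (simp add: blinfun.diff_right positive_opD(1)[OF A] cinner_simps ab c' c_def[symmetric]
          algebra_simps power2_eq_square)
    also have "\<dots> = of_real (a - 2 * t * (cmod c)\<^sup>2 + t\<^sup>2 * (cmod c)\<^sup>2 * b)"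
      using complex_norm_square[of c] by simp
    finally show ?thesis
      using positive_opD(3)[OF A, of "x - ?s *\<^sub>C y"] by simp
  qed
  have "0 \<le> b" using positive_opD(3)[OF A] by (simp add: b_def)
  show ?thesis
  proof (cases "b = 0")
    case True
    have "c = 0"
    proof (rule ccontr)
      assume "c \<noteq> 0"
      then show False
        using ge[of "(a + 1) / (2 * (cmod c)\<^sup>2)"] True by (simp add: field_simps)
    qed
    then show ?thesis using True by (simp add: b_def c_def)
  next
    case False
    then have "0 < b" using \<open>0 \<le> b\<close> by simp
    then have "(cmod c)\<^sup>2 \<le> a * b"
      using ge[of "1 / b"] by (simp add: field_simps power2_eq_square)
    then show ?thesis by (simp add: a_def b_def c_def)
  qed
qed

lemma cinner_Cauchy_Schwarz: "cmod (cinner x y) \<le> norm x * norm y" for x :: "'a::complex_inner"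
proof -
  have "(cmod (cinner x y))\<^sup>2 \<le> (norm x * norm y)\<^sup>2"
    using positive_op_Cauchy_Schwarz[OF positive_op_id, of x y]
    by (simp add: cinner_self power_mult_distrib)
  then show ?thesis by (simp add: power2_le_iff_abs_le)
qed

lemma positive_op_null_vector:
  assumes "positive_op A" "Re (cinner (A x) x) \<le> 0"
  shows "A x = 0"
proof -
  have "Re (cinner (A x) x) = 0" using assms positive_opD(3)[OF assms(1), of x] by simp
  then have "(cmod (cinner (A x) (A x)))\<^sup>2 \<le> 0"
    using positive_op_Cauchy_Schwarz[OF assms(1), of x "A x"] by simp
  then show ?thesis by (simp add: cinner_self)
qed

lemma op_le_refl: "A \<preceq> A"
  by (simp add: op_le_def)

lemma op_le_trans: "A \<preceq> B \<Longrightarrow> B \<preceq> C \<Longrightarrow> A \<preceq> C"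
  by (meson op_le_def order_trans)

lemma positive_op_diff:
  assumes "positive_op A" "positive_op B" "A \<preceq> B"
  shows "positive_op (B - A)"
  using assms
  by (auto simp: positive_op_def complex_linear_iff selfadjoint_def op_le_def
      blinfun.diff_left cinner_simps complex_vector.scale_right_diff_distrib)

lemma op_le_antisym:
  assumes "positive_op A" "positive_op B" "A \<preceq> B" "B \<preceq> A"
  shows "A = B"
proof (rule blinfun_eqI)
  fix x
  have "(B - A) x = 0"
    using assms(4)
    by (intro positive_op_null_vector[OF positive_op_diff[OF assms(1-3)]])
      (simp add: op_le_def blinfun.diff_left cinner_simps)
  then show "A x = B x" by (simp add: blinfun.diff_left)
qed

section \<open>Rank-one operators\<close>

lift_definition rank_one :: "'a::complex_inner \<Rightarrow> ('a \<Rightarrow>\<^sub>L 'a)" is "\<lambda>x z. cinner z x *\<^sub>C x"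
proof (rule bounded_linear_intro)
  fix x y z :: 'a and r :: real
  show "cinner (y + z) x *\<^sub>C x = cinner y x *\<^sub>C x + cinner z x *\<^sub>C x"
    by (simp add: cinner_simps scaleC_add_left)
  show "cinner (r *\<^sub>R y) x *\<^sub>C x = r *\<^sub>R cinner y x *\<^sub>C x"
    by (simp add: cinner_simps scaleR_scaleC scaleC_scaleC)
  show "norm (cinner y x *\<^sub>C x) \<le> norm y * (norm x * norm x)"
    using mult_right_mono[OF cinner_Cauchy_Schwarz[of y x], of "norm x"]
    by (simp add: norm_scaleC mult.assoc)
qed

lemma rank_one_form: "cinner (rank_one x z) z = of_real ((cmod (cinner z x))\<^sup>2)"
proof -
  have "cinner (rank_one x z) z = cinner z x * cnj (cinner z x)"
    by (simp add: rank_one.rep_eq cinner_simps cinner_commute[of x z])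
  then show ?thesis using complex_norm_square[of "cinner z x"] by simp
qed

lemma rank_one_form_self: "Re (cinner (rank_one x x) x) = (norm x) ^ 4"
  by (simp add: rank_one_form cinner_self norm_power)

lemma positive_op_rank_one: "positive_op (rank_one x)"
  by (auto simp: positive_op_def complex_linear_iff selfadjoint_def op_le_def rank_one_form)
    (auto simp: rank_one.rep_eq cinner_simps scaleC_scaleC cinner_commute[of x] mult.commute)

lemma rank_one_scaleR: "rank_one (r *\<^sub>R x) = r\<^sup>2 *\<^sub>R rank_one x"
  by (rule blinfun_eqI)
    (simp add: rank_one.rep_eq scaleR_blinfun.rep_eq cinner_simps scaleR_scaleC scaleC_scaleC
      power2_eq_square ac_simps)

lemma rank_one_eq_0_iff: "rank_one x = 0 \<longleftrightarrow> x = 0"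
proof
  assume "rank_one x = 0"
  then show "x = 0" using rank_one_form[of x x] by (simp add: cinner_self)
qed (auto intro!: blinfun_eqI simp: rank_one.rep_eq)

lemma rank_one_effect_iff: "rank_one x \<in> effects \<longleftrightarrow> norm x \<le> 1"
proof
  assume "rank_one x \<in> effects"
  then have "Re (cinner (rank_one x x) x) \<le> Re (cinner x x)"
    by (simp add: effects_iff op_le_def)
  then have "norm x ^ 4 \<le> norm x ^ 2"
    by (simp add: rank_one_form_self cinner_self)
  then show "norm x \<le> 1"
    using power_strict_increasing[of 2 4 "norm x"] by fastforce
next
  assume "norm x \<le> 1"
  then have "cmod (cinner z x) \<le> norm z" for z
    using cinner_Cauchy_Schwarz[of z x] mult_left_mono[of "norm x" 1 "norm z"] by simp
  then have "(cmod (cinner z x))\<^sup>2 \<le> (norm z)\<^sup>2" for z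
    by (simp add: power_mono)
  then show "rank_one x \<in> effects"
    by (auto simp: effects_iff positive_op_rank_one op_le_def rank_one_form cinner_self)
qed

text \<open>Cauchy--Schwarz for the form of \<^term>\<open>A\<close>, read as an operator inequality: every vector
  in the range of \<^term>\<open>A\<close> spans a rank-one operator below \<^term>\<open>A\<close>.\<close>

lemma rank_one_range_le:
  assumes "positive_op A" "Re (cinner (A w) w) \<le> k"
  shows "rank_one (A w) \<preceq> k *\<^sub>R A"
  unfolding op_le_def
proof
  fix z
  have "(cmod (cinner z (A w)))\<^sup>2 \<le> Re (cinner (A z) z) * Re (cinner (A w) w)"
    using positive_op_Cauchy_Schwarz[OF assms(1), of z w] positive_opD(2)[OF assms(1)] by simp
  also have "\<dots> \<le> Re (cinner (A z) z) * k"
    using assms positive_opD(3)[OF assms(1), of z] by (simp add: mult_left_mono)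
  finally show "Re (cinner (rank_one (A w) z) z) \<le> Re (cinner ((k *\<^sub>R A) z) z)"
    by (simp add: rank_one_form blinfun.scaleR_left cinner_simps mult.commute)
qed

text \<open>The multiple of \<^term>\<open>A w\<close> is chosen so that the rank-one operator agrees with
  \<^term>\<open>A\<close> at \<^term>\<open>w\<close> itself.\<close>

lemma rank_one_below:
  assumes A: "positive_op A" and w: "A w \<noteq> 0"
  obtains r where "0 < r" "rank_one (r *\<^sub>R A w) \<preceq> A"
    "Re (cinner (rank_one (r *\<^sub>R A w) w) w) = Re (cinner (A w) w)"
proof
  define k where "k = Re (cinner (A w) w)"
  have k: "0 < k" using positive_op_null_vector[OF A, of w] w by (force simp: k_def)
  have sq: "(1 / sqrt k)\<^sup>2 = 1 / k" using k by (simp add: power_divide)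
  show "0 < 1 / sqrt k" using k by simp
  have *: "rank_one (A w) \<preceq> k *\<^sub>R A" using rank_one_range_le[OF A] by (simp add: k_def)
  show "rank_one ((1 / sqrt k) *\<^sub>R A w) \<preceq> A"
    unfolding rank_one_scaleR sq using * k
    by (simp add: op_le_def blinfun.scaleR_left cinner_simps field_simps)
  have "cinner w (A w) = of_real k"
    using cinner_selfadjoint_real[OF A, of w] positive_opD(2)[OF A, of w w] by (simp add: k_def)
  then have "cinner (rank_one (A w) w) w = of_real (k\<^sup>2)"
    by (simp add: rank_one_form)
  then show "Re (cinner (rank_one ((1 / sqrt k) *\<^sub>R A w) w) w) = Re (cinner (A w) w)"
    unfolding rank_one_scaleR sq using k
    by (simp add: blinfun.scaleR_left cinner_simps power2_eq_square k_def[symmetric])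
qed

text \<open>A positive operator below a rank-one operator vanishes on the orthogonal complement of
  \<^term>\<open>y\<close>, because its form does.\<close>

lemma below_rank_one:
  assumes B: "positive_op B" and le: "B \<preceq> rank_one y"
  obtains r where "0 \<le> r" "r \<le> 1" "B = r *\<^sub>R rank_one y"
proof (cases "y = 0")
  case True
  then have "B \<preceq> 0" using le rank_one_eq_0_iff[of y] by simp
  then have "B = 0"
    using positive_op_null_vector[OF B] by (intro blinfun_eqI) (auto simp: op_le_def)
  then show ?thesis using that[of 0] by simp
next
  case False
  define n where "n = (norm y)\<^sup>2"
  have n: "0 < n" using False by (simp add: n_def)
  define c where "c z = cinner z y / of_real n" for z
  have orth: "cinner (z - c z *\<^sub>C y) y = 0" for z
    using n by (simp add: cinner_simps c_def cinner_self n_def[symmetric])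
  have ker: "B (z - c z *\<^sub>C y) = 0" for z
  proof (rule positive_op_null_vector[OF B])
    have "Re (cinner (B (z - c z *\<^sub>C y)) (z - c z *\<^sub>C y))
        \<le> Re (cinner (rank_one y (z - c z *\<^sub>C y)) (z - c z *\<^sub>C y))"
      using le by (simp add: op_le_def)
    then show "Re (cinner (B (z - c z *\<^sub>C y)) (z - c z *\<^sub>C y)) \<le> 0"
      unfolding rank_one_form orth by simp
  qed
  define b where "b = Re (cinner (B y) y)"
  have form: "Re (cinner (B z) z) = (b / n\<^sup>2) * (cmod (cinner z y))\<^sup>2" for z
  proof -
    have Bz: "B z = c z *\<^sub>C B y"
      using ker[of z] by (simp add: blinfun.diff_right positive_opD(1)[OF B])
    have "cinner (B z) z = cinner z (B z)" by (rule positive_opD(2)[OF B])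
    also have "\<dots> = cnj (c z) * cinner z (B y)" by (simp add: Bz cinner_simps)
    also have "cinner z (B y) = cinner (B z) y" by (simp add: positive_opD(2)[OF B])
    also have "\<dots> = c z * of_real b"
      using cinner_selfadjoint_real[OF B, of y] by (simp add: Bz cinner_simps b_def)
    finally have "cinner (B z) z = (c z * cnj (c z)) * of_real b" by simp
    then have "Re (cinner (B z) z) = (cmod (c z))\<^sup>2 * b"
      using complex_norm_square[of "c z"] by (metis Re_complex_of_real of_real_mult)
    then show ?thesis using n by (simp add: c_def norm_divide power_divide)
  qed
  have "0 \<le> b" using positive_opD(3)[OF B] by (simp add: b_def)
  have "b \<le> n\<^sup>2"
    using le rank_one_form_self[of y] by (auto simp: op_le_def b_def n_def dest: spec[of _ y])
  show ?thesis
  proof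
    show r: "0 \<le> b / n\<^sup>2" "b / n\<^sup>2 \<le> 1" using \<open>0 \<le> b\<close> \<open>b \<le> n\<^sup>2\<close> n by simp_all
    have "(b / n\<^sup>2) *\<^sub>R rank_one y = rank_one (sqrt (b / n\<^sup>2) *\<^sub>R y)"
      using r by (simp only: rank_one_scaleR real_sqrt_pow2)
    then have "positive_op ((b / n\<^sup>2) *\<^sub>R rank_one y)" by (simp add: positive_op_rank_one)
    then show "B = (b / n\<^sup>2) *\<^sub>R rank_one y"
      by (intro op_le_antisym[OF B])
        (simp_all add: op_le_def form rank_one_form blinfun.scaleR_left cinner_simps)
  qed
qed

section \<open>Order-theoretic descriptions\<close>

definition chain_effect :: "('a::complex_inner \<Rightarrow>\<^sub>L 'a) \<Rightarrow> bool" where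
  "chain_effect A \<longleftrightarrow> (\<forall>B\<in>effects. \<forall>C\<in>effects. B \<preceq> A \<longrightarrow> C \<preceq> A \<longrightarrow> B \<preceq> C \<or> C \<preceq> B)"

definition maximal_chain_effect :: "('a::complex_inner \<Rightarrow>\<^sub>L 'a) \<Rightarrow> bool" where
  "maximal_chain_effect P \<longleftrightarrow>
     chain_effect P \<and> (\<forall>Q\<in>effects. chain_effect Q \<longrightarrow> P \<preceq> Q \<longrightarrow> Q \<preceq> P)"

definition meets :: "('a::complex_inner \<Rightarrow>\<^sub>L 'a) \<Rightarrow> ('a \<Rightarrow>\<^sub>L 'a) \<Rightarrow> bool" where
  "meets P A \<longleftrightarrow> (\<exists>R\<in>effects. \<not> R \<preceq> 0 \<and> R \<preceq> P \<and> R \<preceq> A)"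

text \<open>For rank-one projections \<^term>\<open>P\<close>, \<^term>\<open>Q\<close> and a scalar \<^term>\<open>L\<close> strictly between zero
  and the identity this is orthogonality. It speaks of the join of \<^term>\<open>P\<close> and \<^term>\<open>L\<close>
  through all their upper bounds, as two effects need not have a join.\<close>

definition separated_at ::
  "('a::complex_inner \<Rightarrow>\<^sub>L 'a) \<Rightarrow> ('a \<Rightarrow>\<^sub>L 'a) \<Rightarrow> ('a \<Rightarrow>\<^sub>L 'a) \<Rightarrow> bool" where
  "separated_at L P Q \<longleftrightarrow>
     (\<forall>R\<in>effects. R \<preceq> Q \<longrightarrow> (\<forall>U\<in>effects. P \<preceq> U \<longrightarrow> L \<preceq> U \<longrightarrow> R \<preceq> U) \<longrightarrow> R \<preceq> L)"

text \<open>Each vector outside the kernel of \<^term>\<open>A\<close> yields a rank-one operator below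
  \<^term>\<open>A\<close>. If these are pairwise comparable then they all coincide, and
  \<^term>\<open>A\<close>, whose form they touch at every point, is that operator.\<close>

lemma chain_effect_iff:
  assumes A: "A \<in> effects"
  shows "chain_effect A \<longleftrightarrow> (\<exists>x. norm x \<le> 1 \<and> A = rank_one x)"
proof
  assume "\<exists>x. norm x \<le> 1 \<and> A = rank_one x"
  then obtain x where x: "A = rank_one x" by blast
  show "chain_effect A"
    unfolding chain_effect_def x
  proof (intro ballI impI)
    fix B C :: "'a \<Rightarrow>\<^sub>L 'a"
    assume "B \<in> effects" "C \<in> effects" and le: "B \<preceq> rank_one x" "C \<preceq> rank_one x"
    then have pos: "positive_op B" "positive_op C" by (simp_all add: effects_iff)
    obtain r where r: "B = r *\<^sub>R rank_one x" using below_rank_one[OF pos(1) le(1)] by metis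
    obtain s where s: "C = s *\<^sub>R rank_one x" using below_rank_one[OF pos(2) le(2)] by metis
    show "B \<preceq> C \<or> C \<preceq> B"
      using linear[of r s]
      by (auto simp: r s op_le_def rank_one_form blinfun.scaleR_left cinner_simps mult_right_mono)
  qed
next
  assume chain: "chain_effect A"
  have pos: "positive_op A" and id: "A \<preceq> id_blinfun" using A by (simp_all add: effects_iff)
  have below: "rank_one y \<in> effects" if "rank_one y \<preceq> A" for y
    using that op_le_trans[OF that id] by (simp add: effects_iff positive_op_rank_one)
  show "\<exists>x. norm x \<le> 1 \<and> A = rank_one x"
  proof (cases "A = 0")
    case True
    then show ?thesis
      by (intro exI[of _ 0]) (simp add: rank_one_eq_0_iff)
  next
    case False
    then obtain w where w: "A w \<noteq> 0"
      by (metis blinfun_eqI zero_blinfun.rep_eq)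
    obtain r where r: "0 < r" "rank_one (r *\<^sub>R A w) \<preceq> A"
      "Re (cinner (rank_one (r *\<^sub>R A w) w) w) = Re (cinner (A w) w)"
      using rank_one_below[OF pos w] by blast
    define y where "y = r *\<^sub>R A w"
    have y: "rank_one y \<preceq> A" "Re (cinner (rank_one y w) w) = Re (cinner (A w) w)"
      using r by (simp_all add: y_def)
    have wpos: "0 < Re (cinner (A w) w)"
      using positive_op_null_vector[OF pos, of w] w by force
    \<comment> \<open>The rank-one operators that touch the form of \<^term>\<open>A\<close> at \<^term>\<open>w\<close> and at
      \<^term>\<open>u\<close> are comparable, so the one at \<^term>\<open>w\<close> also dominates at \<^term>\<open>u\<close>.\<close>
    have "A \<preceq> rank_one y"
      unfolding op_le_def
    proof
      fix u
      show "Re (cinner (A u) u) \<le> Re (cinner (rank_one y u) u)"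
      proof (cases "A u = 0")
        case True
        then show ?thesis by (simp add: rank_one_form)
      next
        case False
        then obtain s where s: "rank_one (s *\<^sub>R A u) \<preceq> A"
          "Re (cinner (rank_one (s *\<^sub>R A u) u) u) = Re (cinner (A u) u)"
          using rank_one_below[OF pos False] by blast
        define v where "v = s *\<^sub>R A u"
        have v: "rank_one v \<preceq> A" "Re (cinner (rank_one v u) u) = Re (cinner (A u) u)"
          using s by (simp_all add: v_def)
        consider "rank_one v \<preceq> rank_one y" | "rank_one y \<preceq> rank_one v"
          using chain below y(1) v(1) by (auto simp: chain_effect_def)
        then show ?thesis
        proof cases
          case 1
          then show ?thesis using v(2) by (metis op_le_def)
        next
          case 2
          then obtain t where t: "0 \<le> t" "t \<le> 1" "rank_one y = t *\<^sub>R rank_one v"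
            using below_rank_one[OF positive_op_rank_one] by metis
          have "Re (cinner (A w) w) = t * Re (cinner (rank_one v w) w)"
            using y(2) by (simp add: t blinfun.scaleR_left cinner_simps)
          also have "\<dots> \<le> t * Re (cinner (A w) w)"
            using v(1) t(1) by (simp add: op_le_def mult_left_mono)
          finally have "t = 1" using wpos t(2) by simp
          then show ?thesis using t(3) v(2) by simp
        qed
      qed
    qed
    then have "A = rank_one y"
      using op_le_antisym[OF pos positive_op_rank_one] y(1) by blast
    then show ?thesis using A rank_one_effect_iff by blast
  qed
qed

text \<open>Rescaling a nonzero vector of norm at most one to a unit vector enlarges its rank-one
  operator, so the nonzero maximal elements among the rank-one effects are the rank-one
  projections.\<close>

lemma maximal_chain_effect_unit:
  assumes P: "P \<in> effects" "maximal_chain_effect P" and nz: "P \<noteq> 0"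
  obtains x where "norm x = 1" "P = rank_one x"
proof -
  obtain x where x: "norm x \<le> 1" "P = rank_one x"
    using P chain_effect_iff[OF P(1)] by (auto simp: maximal_chain_effect_def)
  have x0: "x \<noteq> 0" using nz x rank_one_eq_0_iff by blast
  define y where "y = (1 / norm x) *\<^sub>R x"
  have y: "norm y = 1" using x0 by (simp add: y_def)
  then have ye: "rank_one y \<in> effects" by (simp add: rank_one_effect_iff)
  then have "chain_effect (rank_one y)" using chain_effect_iff[OF ye] y by (metis order_refl)
  have "x = norm x *\<^sub>R y" using x0 by (simp add: y_def)
  then have "rank_one x = (norm x)\<^sup>2 *\<^sub>R rank_one y" by (metis rank_one_scaleR)
  moreover have "(norm x)\<^sup>2 \<le> 1" using x(1) by (simp add: abs_square_le_1)
  ultimately have le: "rank_one x \<preceq> rank_one y"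
    by (auto simp: op_le_def rank_one_form blinfun.scaleR_left cinner_simps mult_left_le_one_le)
  then have "rank_one y \<preceq> rank_one x"
    using P(2) ye \<open>chain_effect (rank_one y)\<close> x(2) by (auto simp: maximal_chain_effect_def)
  then have "rank_one x = rank_one y"
    using le op_le_antisym positive_op_rank_one by blast
  then show ?thesis using that[of y] y x(2) by simp
qed

lemma unit_maximal_chain_effect:
  assumes x: "norm x = 1"
  shows "rank_one x \<in> effects" "maximal_chain_effect (rank_one x)"
proof -
  show e: "rank_one x \<in> effects" using x by (simp add: rank_one_effect_iff)
  have "Q \<preceq> rank_one x" if Q: "Q \<in> effects" "chain_effect Q" "rank_one x \<preceq> Q" for Q
  proof -
    obtain y where y: "norm y \<le> 1" "Q = rank_one y"
      using Q chain_effect_iff by blast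
    obtain r where r: "0 \<le> r" "r \<le> 1" "rank_one x = r *\<^sub>R rank_one y"
      using below_rank_one[OF positive_op_rank_one] Q(3) y(2) by metis
    have "cmod (cinner x y) \<le> 1" using cinner_Cauchy_Schwarz[of x y] x y(1) by simp
    then have "(cmod (cinner x y))\<^sup>2 \<le> 1" by (simp add: abs_square_le_1)
    moreover have "1 = r * (cmod (cinner x y))\<^sup>2"
      using arg_cong[OF r(3), of "\<lambda>A. Re (cinner (A x) x)"] x
      by (simp add: rank_one_form blinfun.scaleR_left cinner_simps cinner_self)
    ultimately have "1 \<le> r" using r(1) by (metis mult_left_le)
    then have "r = 1" using r(2) by simp
    then show ?thesis using r(3) y(2) by (simp add: op_le_refl)
  qed
  moreover have "chain_effect (rank_one x)"
    using chain_effect_iff[OF e] x by (metis order_refl)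
  ultimately show "maximal_chain_effect (rank_one x)"
    by (simp add: maximal_chain_effect_def)
qed

section \<open>Orthogonality and zero products in terms of the order\<close>

definition scalar_join :: "real \<Rightarrow> 'a::complex_inner \<Rightarrow> ('a \<Rightarrow>\<^sub>L 'a)" where
  "scalar_join l x = l *\<^sub>R id_blinfun + (1 - l) *\<^sub>R rank_one x"

lemma scalar_join_form:
  "Re (cinner (scalar_join l x z) z) = l * (norm z)\<^sup>2 + (1 - l) * (cmod (cinner z x))\<^sup>2"
  by (simp add: scalar_join_def blinfun.add_left blinfun.scaleR_left cinner_simps cinner_self
      rank_one_form)

lemma unit_cinner_le: "norm x = 1 \<Longrightarrow> (cmod (cinner z x))\<^sup>2 \<le> (norm z)\<^sup>2" for x :: "'a::complex_inner"
  using cinner_Cauchy_Schwarz[of z x] by (simp add: power_mono)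

lemma scalar_join_upper:
  assumes "norm x = 1" "0 < l" "l < 1"
  shows "scalar_join l x \<in> effects" "rank_one x \<preceq> scalar_join l x"
    "l *\<^sub>R id_blinfun \<preceq> scalar_join l x"
proof -
  note le = unit_cinner_le[OF assms(1)]
  have lin: "complex_linear (scalar_join l x)" "selfadjoint (scalar_join l x)"
    using positive_op_rank_one[of x]
    by (auto simp: positive_op_def complex_linear_iff selfadjoint_def scalar_join_def
        blinfun.add_left blinfun.scaleR_left cinner_simps scaleR_scaleC scaleC_scaleC
        scaleC_add_right mult.commute)
  have "l * (norm z)\<^sup>2 + (1 - l) * (cmod (cinner z x))\<^sup>2 \<le> l * (norm z)\<^sup>2 + (1 - l) * (norm z)\<^sup>2" for z
    using le[of z] assms by (intro add_left_mono mult_left_mono) auto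
  then have "l * (norm z)\<^sup>2 + (1 - l) * (cmod (cinner z x))\<^sup>2 \<le> (norm z)\<^sup>2" for z
    by (simp add: algebra_simps)
  then show "scalar_join l x \<in> effects"
    using lin assms by (auto simp: effects_def op_le_def scalar_join_form cinner_self)
  have "l * (cmod (cinner z x))\<^sup>2 \<le> l * (norm z)\<^sup>2" for z
    using le[of z] assms by simp
  then show "rank_one x \<preceq> scalar_join l x"
    by (simp add: op_le_def scalar_join_form rank_one_form algebra_simps)
  show "l *\<^sub>R id_blinfun \<preceq> scalar_join l x"
    using assms
    by (simp add: op_le_def scalar_join_form blinfun.scaleR_left cinner_simps cinner_self)
qed

text \<open>An effect above the projection onto \<^term>\<open>x\<close> fixes \<^term>\<open>x\<close>, so it splits along
  \<^term>\<open>x\<close> and its orthogonal complement, and on the complement only the scalar bound remains.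
  This is why the join with a scalar exists, and it uses that \<^term>\<open>x\<close> is a unit vector.\<close>

lemma scalar_join_least:
  assumes x: "norm x = 1" and U: "U \<in> effects" "rank_one x \<preceq> U" "l *\<^sub>R id_blinfun \<preceq> U"
  shows "scalar_join l x \<preceq> U"
  unfolding op_le_def
proof
  fix z
  define V where "V = id_blinfun - U"
  have V: "positive_op V"
    using U(1) positive_op_diff[OF _ positive_op_id] by (auto simp: effects_iff V_def)
  have "1 \<le> Re (cinner (U x) x)"
    using U(2) x by (auto simp: op_le_def rank_one_form cinner_self dest: spec[of _ x])
  then have Vx: "V x = 0"
    using x by (intro positive_op_null_vector[OF V])
      (simp add: V_def blinfun.diff_left cinner_simps cinner_self)
  define w where "w = z - cinner z x *\<^sub>C x"
  have Vz: "V z = V w"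
    by (simp add: w_def blinfun.diff_right positive_opD(1)[OF V] Vx)
  have "cinner (V w) x = 0" using positive_opD(2)[OF V, of w x] Vx by simp
  then have "cinner (V z) z = cinner (V w) w"
    by (simp add: Vz) (simp add: w_def cinner_simps)
  moreover have "Re (cinner (V w) w) \<le> (1 - l) * (norm w)\<^sup>2"
    using U(3)
    by (auto simp: op_le_def V_def blinfun.diff_left blinfun.scaleR_left cinner_simps cinner_self
        algebra_simps dest: spec[of _ w])
  moreover have "(norm w)\<^sup>2 = (norm z)\<^sup>2 - (cmod (cinner z x))\<^sup>2"
  proof -
    have "of_real ((norm w)\<^sup>2) = cinner w w" by (simp only: cinner_self)
    also have "\<dots> = of_real ((norm z)\<^sup>2) - cinner z x * cnj (cinner z x)"
      unfolding w_def cinner_simps using x by (simp add: cinner_self cinner_commute[of x z])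
    also have "\<dots> = complex_of_real ((norm z)\<^sup>2 - (cmod (cinner z x))\<^sup>2)"
      using complex_norm_square[of "cinner z x"] by simp
    finally show ?thesis by (simp only: of_real_eq_iff)
  qed
  ultimately have "Re (cinner (V z) z) \<le> (1 - l) * ((norm z)\<^sup>2 - (cmod (cinner z x))\<^sup>2)"
    by simp
  then show "Re (cinner (scalar_join l x z) z) \<le> Re (cinner (U z) z)"
    by (simp add: scalar_join_form V_def blinfun.diff_left cinner_simps cinner_self algebra_simps)
qed

text \<open>The largest multiple of the projection onto \<^term>\<open>y\<close> below an invertible \<^term>\<open>T\<close>
  has the factor \<open>1 / \<langle>T\<inverse> y, y\<rangle>\<close>. For the join \<^term>\<open>T\<close> this factor exceeds \<^term>\<open>l\<close> as
  soon as \<^term>\<open>y\<close> has a component along \<^term>\<open>x\<close>.\<close>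

lemma separated_at_iff_orthogonal:
  assumes x: "norm x = 1" and y: "norm y = 1" and l: "0 < l" "l < 1"
  shows "separated_at (l *\<^sub>R id_blinfun) (rank_one x) (rank_one y) \<longleftrightarrow> cinner x y = 0"
proof
  assume orth: "cinner x y = 0"
  show "separated_at (l *\<^sub>R id_blinfun) (rank_one x) (rank_one y)"
    unfolding separated_at_def
  proof (intro ballI impI)
    fix R :: "'a \<Rightarrow>\<^sub>L 'a"
    assume R: "R \<in> effects" "R \<preceq> rank_one y"
      and "\<forall>U\<in>effects. rank_one x \<preceq> U \<longrightarrow> l *\<^sub>R id_blinfun \<preceq> U \<longrightarrow> R \<preceq> U"
    then have RT: "R \<preceq> scalar_join l x" using scalar_join_upper[OF x l] by blast
    obtain r where r: "0 \<le> r" "R = r *\<^sub>R rank_one y"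
      using below_rank_one[OF _ R(2)] R(1) by (metis effects_iff)
    have "cinner y x = 0" using orth cinner_commute[of y x] by simp
    then have "r \<le> l"
      using RT y
      by (auto simp: op_le_def r scalar_join_form blinfun.scaleR_left cinner_simps rank_one_form
          cinner_self dest!: spec[of _ y])
    then have "r * (cmod (cinner z y))\<^sup>2 \<le> l * (norm z)\<^sup>2" for z
      using unit_cinner_le[OF y, of z] l by (intro mult_mono) auto
    then show "R \<preceq> l *\<^sub>R id_blinfun"
      by (simp add: op_le_def r blinfun.scaleR_left cinner_simps rank_one_form cinner_self)
  qed
next
  assume sep: "separated_at (l *\<^sub>R id_blinfun) (rank_one x) (rank_one y)"
  show "cinner x y = 0"
  proof (rule ccontr)
    assume "cinner x y \<noteq> 0"
    define T where "T = scalar_join l x"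
    have Tpos: "positive_op T" using scalar_join_upper(1)[OF x l] by (simp add: T_def effects_iff)
    define c where "c = cinner y x"
    have c: "c \<noteq> 0" using \<open>cinner x y \<noteq> 0\<close> cinner_commute[of x y] by (auto simp: c_def)
    \<comment> \<open>The preimage of \<^term>\<open>y\<close> under \<^term>\<open>T\<close>, which acts as \<^term>\<open>l\<close> on the
      complement of \<^term>\<open>x\<close> and as the identity along \<^term>\<open>x\<close>.\<close>
    define w where "w = (1 / l) *\<^sub>R (y - c *\<^sub>C x) + c *\<^sub>C x"
    define k where "k = (1 - (cmod c)\<^sup>2) / l + (cmod c)\<^sup>2"
    have wx: "cinner w x = c"
      using x by (simp add: w_def cinner_simps cinner_self c_def[symmetric])
    have "T w = l *\<^sub>R w + (1 - l) *\<^sub>R (c *\<^sub>C x)"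
      by (simp add: T_def scalar_join_def blinfun.add_left blinfun.scaleR_left rank_one.rep_eq wx)
    also have "\<dots> = y"
      using l by (simp add: w_def algebra_simps scaleR_add_right)
    finally have Tw: "T w = y" .
    have "cinner y w = of_real (1 / l) * (1 - c * cnj c) + c * cnj c"
      using y by (simp add: w_def cinner_simps cinner_self c_def[symmetric] algebra_simps)
    also have "\<dots> = of_real k"
      using complex_norm_square[of c] by (simp add: k_def)
    finally have form: "Re (cinner (T w) w) = k" by (simp add: Tw)
    have c1: "(cmod c)\<^sup>2 \<le> 1" using unit_cinner_le[OF x, of y] y by (simp add: c_def)
    have c0: "0 < (cmod c)\<^sup>2" using c by simp
    have k0: "1 \<le> k"
    proof -
      have "(1 - (cmod c)\<^sup>2) * 1 \<le> (1 - (cmod c)\<^sup>2) * (1 / l)"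
        using c1 l by (intro mult_left_mono) auto
      then show ?thesis by (simp add: k_def)
    qed
    have kl: "k * l < 1"
    proof -
      have "k * l = 1 - (1 - l) * (cmod c)\<^sup>2" using l by (simp add: k_def field_simps)
      then show ?thesis using c0 l by simp
    qed
    define R where "R = rank_one ((1 / sqrt k) *\<^sub>R y)"
    have sq: "(1 / sqrt k)\<^sup>2 = 1 / k" using k0 by (simp add: power_divide)
    have R: "R = (1 / k) *\<^sub>R rank_one y" by (simp only: R_def rank_one_scaleR sq)
    have "rank_one y \<preceq> k *\<^sub>R T" using rank_one_range_le[OF Tpos, of w k] form Tw by simp
    then have RT: "R \<preceq> T"
      using k0 by (simp add: R op_le_def blinfun.scaleR_left cinner_simps field_simps)
    have "R \<in> effects" using k0 y by (simp add: R_def rank_one_effect_iff)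
    moreover have "R \<preceq> rank_one y"
      using k0 by (simp add: R op_le_def blinfun.scaleR_left cinner_simps rank_one_form
          divide_le_eq mult_le_cancel_left1)
    moreover have "\<forall>U\<in>effects. rank_one x \<preceq> U \<longrightarrow> l *\<^sub>R id_blinfun \<preceq> U \<longrightarrow> R \<preceq> U"
      using scalar_join_least[OF x] RT op_le_trans unfolding T_def by blast
    ultimately have "R \<preceq> l *\<^sub>R id_blinfun" using sep by (simp add: separated_at_def)
    then have "1 / k \<le> l"
      using y by (auto simp: op_le_def R blinfun.scaleR_left cinner_simps rank_one_form cinner_self
          dest!: spec[of _ y])
    then show False using kl k0 by (simp add: divide_le_eq mult.commute)
  qed
qed

lemma meets_unit_iff:
  assumes x: "norm x = 1" and A: "A \<in> effects"
  shows "meets (rank_one x) A \<longleftrightarrow> (\<exists>r>0. r *\<^sub>R rank_one x \<preceq> A)"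
proof
  assume "meets (rank_one x) A"
  then obtain R where R: "R \<in> effects" "\<not> R \<preceq> 0" "R \<preceq> rank_one x" "R \<preceq> A"
    by (auto simp: meets_def)
  then obtain r where r: "0 \<le> r" "R = r *\<^sub>R rank_one x"
    using below_rank_one[OF _ R(3)] by (metis effects_iff)
  have "r \<noteq> 0" using R(2) r(2) by (auto simp: op_le_refl)
  then have "0 < r" using r(1) by simp
  then show "\<exists>r>0. r *\<^sub>R rank_one x \<preceq> A" using r(2) R(4) by blast
next
  assume "\<exists>r>0. r *\<^sub>R rank_one x \<preceq> A"
  then obtain r where r: "0 < r" "r *\<^sub>R rank_one x \<preceq> A" by blast
  have "r *\<^sub>R rank_one x \<preceq> id_blinfun" using r(2) A op_le_trans by (auto simp: effects_iff)
  then have r1: "r \<le> 1"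
    using x by (auto simp: op_le_def blinfun.scaleR_left cinner_simps rank_one_form cinner_self
        dest!: spec[of _ x])
  have eq: "r *\<^sub>R rank_one x = rank_one (sqrt r *\<^sub>R x)" using r(1) by (simp add: rank_one_scaleR)
  have "r *\<^sub>R rank_one x \<in> effects"
    unfolding eq using r(1) r1 x by (simp add: rank_one_effect_iff)
  moreover have "\<not> r *\<^sub>R rank_one x \<preceq> 0"
    using r(1) x by (auto simp: op_le_def blinfun.scaleR_left cinner_simps rank_one_form cinner_self
        intro!: exI[of _ x])
  moreover have "r *\<^sub>R rank_one x \<preceq> rank_one x"
    using r1 r(1) by (simp add: op_le_def blinfun.scaleR_left cinner_simps rank_one_form
        mult_left_le_one_le)
  ultimately show "meets (rank_one x) A" using r(2) by (auto simp: meets_def)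
qed

lemma meets_range_direction:
  assumes A: "A \<in> effects" and w: "A w \<noteq> 0"
  shows "meets (rank_one ((1 / norm (A w)) *\<^sub>R A w)) A"
proof -
  define x where "x = (1 / norm (A w)) *\<^sub>R A w"
  have x: "norm x = 1" "A w = norm (A w) *\<^sub>R x" using w by (simp_all add: x_def)
  have "positive_op A" using A by (simp add: effects_iff)
  then obtain r where r: "0 < r" "rank_one (r *\<^sub>R A w) \<preceq> A"
    using rank_one_below w by metis
  have "rank_one (r *\<^sub>R A w) = (r * norm (A w))\<^sup>2 *\<^sub>R rank_one x"
    by (metis rank_one_scaleR scaleR_scaleR x(2))
  moreover have "0 < (r * norm (A w))\<^sup>2" using r(1) w by simp
  ultimately have "meets (rank_one x) A"
    using meets_unit_iff[OF x(1) A] r(2) by auto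
  then show ?thesis by (simp add: x_def)
qed

text \<open>The product of two effects vanishes exactly if their ranges are orthogonal, and the
  directions of rank-one operators below an effect contain its range and lie in the closure of
  its range.\<close>

lemma zero_product_iff:
  assumes A: "A \<in> effects" and B: "B \<in> effects"
  shows "A o\<^sub>L B = 0 \<longleftrightarrow>
    (\<forall>x y. norm x = 1 \<longrightarrow> norm y = 1 \<longrightarrow> meets (rank_one x) A \<longrightarrow> meets (rank_one y) B
      \<longrightarrow> cinner x y = 0)"
proof
  assume AB: "A o\<^sub>L B = 0"
  show "\<forall>x y. norm x = 1 \<longrightarrow> norm y = 1 \<longrightarrow> meets (rank_one x) A \<longrightarrow> meets (rank_one y) B
      \<longrightarrow> cinner x y = 0"
  proof (intro allI impI)
    fix x y :: 'a
    assume xy: "norm x = 1" "norm y = 1" "meets (rank_one x) A" "meets (rank_one y) B"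
    obtain r where r: "0 < r" "r *\<^sub>R rank_one x \<preceq> A" using xy A meets_unit_iff by blast
    obtain s where s: "0 < s" "s *\<^sub>R rank_one y \<preceq> B" using xy B meets_unit_iff by blast
    have "A (B x) = 0"
      using arg_cong[OF AB, of "\<lambda>C. blinfun_apply C x"] by simp
    then have "r * (cmod (cinner (B x) x))\<^sup>2 \<le> 0"
      using r(2) by (auto simp: op_le_def blinfun.scaleR_left cinner_simps rank_one_form
          dest!: spec[of _ "B x"])
    then have "cinner (B x) x = 0" using r(1) by (simp add: mult_le_0_iff)
    then have "s * (cmod (cinner x y))\<^sup>2 \<le> 0"
      using s(2) by (auto simp: op_le_def blinfun.scaleR_left cinner_simps rank_one_form
          dest!: spec[of _ x])
    then show "cinner x y = 0" using s(1) by (simp add: mult_le_0_iff)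
  qed
next
  have pos: "positive_op A" using A by (simp add: effects_iff)
  assume orth: "\<forall>x y. norm x = 1 \<longrightarrow> norm y = 1 \<longrightarrow> meets (rank_one x) A \<longrightarrow>
      meets (rank_one y) B \<longrightarrow> cinner x y = 0"
  have "A (B u) = 0" for u
  proof (rule ccontr)
    assume nz: "A (B u) \<noteq> 0"
    define w where "w = A (B u)"
    have "cinner (A w) (B u) = of_real ((norm w)\<^sup>2)"
      using positive_opD(2)[OF pos, of w "B u"] by (simp add: w_def cinner_self)
    then have ip: "cinner (A w) (B u) \<noteq> 0" using nz by (simp add: w_def)
    then have Aw: "A w \<noteq> 0" and Bu: "B u \<noteq> 0" by auto
    have "cinner ((1 / norm (A w)) *\<^sub>R A w) ((1 / norm (B u)) *\<^sub>R B u) = 0"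
      using orth meets_range_direction[OF A Aw] meets_range_direction[OF B Bu] Aw Bu by simp
    then show False using ip Aw Bu by (simp add: cinner_simps)
  qed
  then show "A o\<^sub>L B = 0" by (intro blinfun_eqI) simp
qed

lemma zero_product_order_iff:
  assumes A: "A \<in> effects" and B: "B \<in> effects" and l: "0 < l" "l < 1"
  shows "A o\<^sub>L B = 0 \<longleftrightarrow>
    (\<forall>P\<in>effects. \<forall>Q\<in>effects. maximal_chain_effect P \<longrightarrow> maximal_chain_effect Q \<longrightarrow>
      meets P A \<longrightarrow> meets Q B \<longrightarrow> separated_at (l *\<^sub>R id_blinfun) P Q)"
    (is "_ \<longleftrightarrow> ?rhs")
proof
  assume AB: "A o\<^sub>L B = 0"
  show ?rhs
  proof (intro ballI impI)
    fix P Q :: "'a \<Rightarrow>\<^sub>L 'a"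
    assume P: "P \<in> effects" "maximal_chain_effect P" "meets P A"
      and Q: "Q \<in> effects" "maximal_chain_effect Q" "meets Q B"
    have "P \<noteq> 0" "Q \<noteq> 0" using P(3) Q(3) op_le_refl by (auto simp: meets_def)
    obtain x where x: "norm x = 1" "P = rank_one x"
      using maximal_chain_effect_unit[OF P(1,2) \<open>P \<noteq> 0\<close>] .
    obtain y where y: "norm y = 1" "Q = rank_one y"
      using maximal_chain_effect_unit[OF Q(1,2) \<open>Q \<noteq> 0\<close>] .
    have "cinner x y = 0"
      using AB zero_product_iff[OF A B] P(3) Q(3) x y by blast
    then show "separated_at (l *\<^sub>R id_blinfun) P Q"
      using separated_at_iff_orthogonal[OF x(1) y(1) l] x(2) y(2) by simp
  qed
next
  assume ?rhs
  then show "A o\<^sub>L B = 0"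
    unfolding zero_product_iff[OF A B]
  proof (intro allI impI)
    fix x y :: 'a
    assume xy: "norm x = 1" "norm y = 1" "meets (rank_one x) A" "meets (rank_one y) B"
    then have "separated_at (l *\<^sub>R id_blinfun) (rank_one x) (rank_one y)"
      using \<open>?rhs\<close> unit_maximal_chain_effect by blast
    then show "cinner x y = 0" using separated_at_iff_orthogonal[OF xy(1,2) l] by simp
  qed
qed

section \<open>Order automorphisms\<close>

locale effect_order_automorphism =
  fixes \<phi> :: "('a::complex_inner \<Rightarrow>\<^sub>L 'a) \<Rightarrow> ('a \<Rightarrow>\<^sub>L 'a)"
  assumes image: "\<phi> ` effects = effects"
    and order: "A \<in> effects \<Longrightarrow> B \<in> effects \<Longrightarrow> \<phi> A \<preceq> \<phi> B \<longleftrightarrow> A \<preceq> B"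
begin

lemma closed: "A \<in> effects \<Longrightarrow> \<phi> A \<in> effects"
  using image by blast

lemma ball_effects: "(\<forall>B\<in>effects. F B) \<longleftrightarrow> (\<forall>B\<in>effects. F (\<phi> B))"
  by (subst image[symmetric]) simp

lemma bex_effects: "(\<exists>B\<in>effects. F B) \<longleftrightarrow> (\<exists>B\<in>effects. F (\<phi> B))"
  by (subst image[symmetric]) simp

lemma zero_effect: "(0 :: 'a \<Rightarrow>\<^sub>L 'a) \<in> effects"
  using rank_one_effect_iff[of "0 :: 'a"] rank_one_eq_0_iff[of "0 :: 'a"] by simp

lemma below_zero:
  assumes A: "A \<in> effects"
  shows "\<phi> A \<preceq> 0 \<longleftrightarrow> A \<preceq> 0"
proof -
  have least: "0 \<preceq> B" if "B \<in> effects" for B :: "'a \<Rightarrow>\<^sub>L 'a"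
    using that by (simp add: effects_def)
  obtain Z where Z: "Z \<in> effects" "\<phi> Z = 0" using zero_effect image by (metis imageE)
  have "\<phi> Z \<preceq> \<phi> 0" using least[OF closed[OF zero_effect]] Z(2) by simp
  then have "Z \<preceq> 0" using order[OF Z(1) zero_effect] by simp
  moreover have "\<phi> A \<preceq> 0 \<longleftrightarrow> A \<preceq> Z" using order[OF A Z(1)] Z(2) by simp
  ultimately show ?thesis using least[OF Z(1)] by (blast intro: op_le_trans)
qed

lemma chain_effect_image:
  assumes "A \<in> effects"
  shows "chain_effect (\<phi> A) \<longleftrightarrow> chain_effect A"
proof -
  have "chain_effect (\<phi> A) \<longleftrightarrow> (\<forall>B\<in>effects. \<forall>C\<in>effects. \<phi> B \<preceq> \<phi> A \<longrightarrow> \<phi> C \<preceq> \<phi> A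
      \<longrightarrow> \<phi> B \<preceq> \<phi> C \<or> \<phi> C \<preceq> \<phi> B)"
    unfolding chain_effect_def by (subst ball_effects, subst (2) ball_effects) (rule refl)
  then show ?thesis using assms by (simp add: order chain_effect_def cong: ball_cong)
qed

lemma maximal_chain_effect_image:
  assumes "P \<in> effects"
  shows "maximal_chain_effect (\<phi> P) \<longleftrightarrow> maximal_chain_effect P"
  unfolding maximal_chain_effect_def
  by (subst ball_effects) (use assms in \<open>simp add: order chain_effect_image cong: ball_cong\<close>)

lemma meets_image:
  assumes "P \<in> effects" "A \<in> effects"
  shows "meets (\<phi> P) (\<phi> A) \<longleftrightarrow> meets P A"
  unfolding meets_def
  by (subst bex_effects) (use assms in \<open>simp add: order below_zero cong: bex_cong\<close>)

lemma separated_at_image: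
  assumes "L \<in> effects" "P \<in> effects" "Q \<in> effects"
  shows "separated_at (\<phi> L) (\<phi> P) (\<phi> Q) \<longleftrightarrow> separated_at L P Q"
proof -
  have "separated_at (\<phi> L) (\<phi> P) (\<phi> Q) \<longleftrightarrow> (\<forall>R\<in>effects. \<phi> R \<preceq> \<phi> Q \<longrightarrow>
      (\<forall>U\<in>effects. \<phi> P \<preceq> \<phi> U \<longrightarrow> \<phi> L \<preceq> \<phi> U \<longrightarrow> \<phi> R \<preceq> \<phi> U) \<longrightarrow> \<phi> R \<preceq> \<phi> L)"
    unfolding separated_at_def by (subst ball_effects, subst (2) ball_effects) (rule refl)
  then show ?thesis using assms by (simp add: order separated_at_def cong: ball_cong)
qed

end

theorem proposition2:
  fixes \<phi> :: "('a::complex_hilbert \<Rightarrow>\<^sub>L 'a) \<Rightarrow> ('a \<Rightarrow>\<^sub>L 'a)"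
  assumes dim: "cdim TYPE('a) \<ge> 2"
    and bij: "bij_betw \<phi> effects effects"
    and order: "\<And>A B. A \<in> effects \<Longrightarrow> B \<in> effects \<Longrightarrow> A \<preceq> B \<longleftrightarrow> \<phi> A \<preceq> \<phi> B"
    and scalar: "\<exists>\<alpha>\<in>{0<..<1::real}. \<exists>\<mu>\<in>{0<..<1::real}.
      \<phi> (\<alpha> *\<^sub>R id_blinfun) = \<mu> *\<^sub>R id_blinfun"
  shows "\<forall>A\<in>effects. \<forall>B\<in>effects. A o\<^sub>L B = 0 \<longleftrightarrow> \<phi> A o\<^sub>L \<phi> B = 0"
proof (intro ballI)
  fix A B :: "'a \<Rightarrow>\<^sub>L 'a"
  assume A: "A \<in> effects" and B: "B \<in> effects"
  interpret effect_order_automorphism \<phi>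
    using bij order by unfold_locales (auto simp: bij_betw_def)
  obtain \<alpha> \<mu> :: real where \<alpha>: "0 < \<alpha>" "\<alpha> < 1" and \<mu>: "0 < \<mu>" "\<mu> < 1"
    and \<phi>\<alpha>: "\<phi> (\<alpha> *\<^sub>R id_blinfun) = \<mu> *\<^sub>R id_blinfun"
    using scalar by auto
  have scalar_effect: "\<alpha> *\<^sub>R id_blinfun \<in> (effects :: ('a \<Rightarrow>\<^sub>L 'a) set)"
    using \<alpha>
    by (auto simp: effects_def complex_linear_iff selfadjoint_def op_le_def blinfun.scaleR_left
        cinner_simps cinner_self scaleR_scaleC scaleC_scaleC mult.commute mult_left_le_one_le)
  let ?orth = "\<lambda>L A B. \<forall>P\<in>effects. \<forall>Q\<in>effects. maximal_chain_effect P \<longrightarrow>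
    maximal_chain_effect Q \<longrightarrow> meets P A \<longrightarrow> meets Q B \<longrightarrow> separated_at L P Q"
  have "\<phi> A o\<^sub>L \<phi> B = 0 \<longleftrightarrow> ?orth (\<phi> (\<alpha> *\<^sub>R id_blinfun)) (\<phi> A) (\<phi> B)"
    using zero_product_order_iff[OF closed[OF A] closed[OF B] \<mu>] by (simp only: \<phi>\<alpha>)
  also have "\<dots> \<longleftrightarrow> (\<forall>P\<in>effects. \<forall>Q\<in>effects. maximal_chain_effect (\<phi> P) \<longrightarrow>
    maximal_chain_effect (\<phi> Q) \<longrightarrow> meets (\<phi> P) (\<phi> A) \<longrightarrow> meets (\<phi> Q) (\<phi> B) \<longrightarrow>
    separated_at (\<phi> (\<alpha> *\<^sub>R id_blinfun)) (\<phi> P) (\<phi> Q))"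
    by (subst ball_effects, subst (2) ball_effects) (rule refl)
  also have "\<dots> \<longleftrightarrow> ?orth (\<alpha> *\<^sub>R id_blinfun) A B"
    using A B scalar_effect
    by (simp add: maximal_chain_effect_image meets_image separated_at_image cong: ball_cong)
  also have "\<dots> \<longleftrightarrow> A o\<^sub>L B = 0"
    using zero_product_order_iff[OF A B \<alpha>] by simp
  finally show "A o\<^sub>L B = 0 \<longleftrightarrow> \<phi> A o\<^sub>L \<phi> B = 0" by blast
qed

end
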